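(* Let $(\Omega,d)$ be a complete separable metric space and $\mu$ a Borel probability measure on $\Omega$. Let $\varphi,\Phi:\mathbb{R}_+\to\mathbb{R}$ be convex non-decreasing continuous functions, with $\varphi$ non-negative and $\varphi(0)=0$. Assume that $(\Omega,d,\mu)$ satisfies a $(\varphi,\Phi)$-Transport-Entropy inequality, or equivalently, a $(\varphi,\Phi)$-Infimum-Convolution inequality, and denote $\Psi:=\Phi\circ\varphi$. Let $L>0$. Then for any $L$-log-Lipschitz function $f$ on $(\Omega,d)$ and any $p>0$: $$C_{L,p,\Psi}^{-1}\,\|f\|_{L^p(\mu)} \leq \|f\|_{L^0(\mu)} \leq C_{L,p,\Psi}\,\|f\|_{L^{-p}(\mu)},$$ with $$C_{L,p,\Psi} = \exp\left(\Psi^*(pL)/p\right)\in[1,\infty].$$ In particular, denoting $S:=\lim_{t\to\infty}\Psi(t)/t$: 1. If $S=+\infty$ then $C_{L,p,\Psi}<\infty$ for all $p>0$, and hence all $p$-moments of any log-Lipschitz function are comparable. 2. If $S<\infty$ then $C_{L,p,\Psi}<\infty$ for all $p\in(0,S/L)$, and hence the $p$-moments of an $L$-log-Lipschitz function are comparable in the range $p\in(-S/L,S/L)$.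
   Context: $\mathbb{R}_+=[0,\infty)$. A positive function $f:\Omega\to(0,\infty)$ is $L$-log-Lipschitz if $|\log f(x)-\log f(y)|\leq L\,d(x,y)$ for all $x,y\in\Omega$; it is log-Lipschitz if it is $L$-log-Lipschitz for some $L>0$. For a positive Borel function $f$ and $p\in\mathbb{R}\setminus\{0\}$, $\|f\|_{L^p(\mu)}:=\left(\int f^p\,d\mu\right)^{1/p}$, and $\|f\|_{L^0(\mu)}:=\exp\left(\int\log f\,d\mu\right)$. That $p$-moments are comparable in a range $I$ means that for all $q<p$ in $I$, $\|f\|_{L^p(\mu)}\leq C\,\|f\|_{L^q(\mu)}$ with a finite constant $C$ depending only on $p,q,L,\Psi$ (where $f$ is $L$-log-Lipschitz). Legendre–Fenchel transform: for a convex non-decreasing $\Theta:\mathbb{R}_+\to\mathbb{R}$ (in particular for $\varphi$, $\Phi$, $\Psi$), $\Theta^*(s):=\sup_{t>0}\{st-\Theta(t)\}\in\mathbb{R}\cup\{+\infty\}$ for $s\ge 0$. Cost: $c_\varphi(x,y):=\varphi(d(x,y))$. For Borel probability measures $\nu_1,\nu_2$ on $\Omega$, $W_{c_\varphi}(\nu_1,\nu_2):=\inf\int_{\Omega\times\Omega}c_\varphi(x,y)\,d\Pi(x,y)$, the infimum being over probability measures $\Pi$ on $\Omega\times\Omega$ with marginals $\nu_1,\nu_2$. Relative entropy: $H(\nu|\mu):=\int\log\left(\frac{d\nu}{d\mu}\right)d\nu$ if $\nu\ll\mu$, and $+\infty$ otherwise. $(\Omega,d,\mu)$ satisfies a $(\varphi,\Phi)$-Transport-Entropy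 inequality if $W_{c_\varphi}(\nu,\mu)\leq\Phi^{-1}(H(\nu|\mu))$ for every Borel probability measure $\nu$ on $\Omega$, where $\Phi^{-1}(y):=\sup\{t\geq0:\Phi(t)\leq y\}$ (with $\sup\emptyset=-\infty$). $(\Omega,d,\mu)$ satisfies a $(\varphi,\Phi)$-Infimum-Convolution inequality if for every $\mu$-integrable $g:\Omega\to\mathbb{R}$, $$\int\exp(\lambda Q_{c_\varphi}g)\,d\mu\leq\exp\left(\lambda\int g\,d\mu+\Phi^*(\lambda)\right)\quad\forall\lambda>0,$$ where $Q_{c_\varphi}g(x):=\inf_{y\in\Omega}\left(g(y)+c_\varphi(x,y)\right)$. It is a known fact that these two inequalities are equivalent. *)

theory Defs
  imports "HOL-Probability.Probability"
begin

definition exp_ereal :: "ereal \<Rightarrow> ennreal" where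
  "exp_ereal x = (case x of ereal r \<Rightarrow> ennreal (exp r) | PInfty \<Rightarrow> \<infinity> | MInfty \<Rightarrow> 0)"

text \<open>Only used for nonzero exponents.\<close>

definition powr_ennreal :: "ennreal \<Rightarrow> real \<Rightarrow> ennreal" where
  "powr_ennreal x a =
    (if x = \<infinity> then (if a < 0 then 0 else \<infinity>)
     else if x = 0 \<and> a < 0 then \<infinity>
     else ennreal (enn2real x powr a))"

text \<open>The integral of a real function with values in the extended reals. It is meaningful as soon
  as the positive or the negative part is integrable; the library's convention gives
  \<open>\<infinity> - \<infinity> = \<infinity>\<close> otherwise.\<close>

definition ext_integral :: "'a measure \<Rightarrow> ('a \<Rightarrow> real) \<Rightarrow> ereal" where
  "ext_integral M g =
    enn2ereal (\<integral>\<^sup>+ x. ennreal (g x) \<partial>M) - enn2ereal (\<integral>\<^sup>+ x. ennreal (- g x) \<partial>M)"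

definition log_lipschitz :: "real \<Rightarrow> ('a :: metric_space \<Rightarrow> real) \<Rightarrow> bool" where
  "log_lipschitz L f \<longleftrightarrow>
    (\<forall>x. 0 < f x) \<and> (\<forall>x y. \<bar>ln (f x) - ln (f y)\<bar> \<le> L * dist x y)"

definition Lp_moment :: "'a measure \<Rightarrow> real \<Rightarrow> ('a \<Rightarrow> real) \<Rightarrow> ennreal" where
  "Lp_moment M p f =
    (if p = 0 then exp_ereal (ext_integral M (\<lambda>x. ln (f x)))
     else powr_ennreal (\<integral>\<^sup>+ x. ennreal (f x powr p) \<partial>M) (1 / p))"

definition legendre :: "(real \<Rightarrow> real) \<Rightarrow> real \<Rightarrow> ereal" where
  "legendre \<Theta> s = (SUP t\<in>{0<..}. ereal (s * t - \<Theta> t))"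

definition borel_prob :: "'a :: topological_space measure \<Rightarrow> bool" where
  "borel_prob \<nu> \<longleftrightarrow> prob_space \<nu> \<and> sets \<nu> = sets borel"

definition couplings ::
  "'a :: topological_space measure \<Rightarrow> 'a measure \<Rightarrow> ('a \<times> 'a) measure set" where
  "couplings \<nu>1 \<nu>2 =
    {P. borel_prob P \<and> distr P borel fst = \<nu>1 \<and> distr P borel snd = \<nu>2}"

definition transport_cost ::
  "(real \<Rightarrow> real) \<Rightarrow> 'a :: metric_space measure \<Rightarrow> 'a measure \<Rightarrow> ennreal" where
  "transport_cost \<phi> \<nu>1 \<nu>2 =
    (INF P \<in> couplings \<nu>1 \<nu>2. \<integral>\<^sup>+ z. ennreal (\<phi> (dist (fst z) (snd z))) \<partial>P)"

definition rel_entropy :: "'a measure \<Rightarrow> 'a measure \<Rightarrow> ereal" where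
  "rel_entropy \<nu> \<mu> =
    (if absolutely_continuous \<mu> \<nu>
     then ext_integral \<nu> (\<lambda>x. ln (enn2real (RN_deriv \<mu> \<nu> x))) else \<infinity>)"

text \<open>As \<open>Sup {} = - \<infinity>\<close> in the extended reals, this includes the convention for the empty set;
  the value is \<open>\<infinity>\<close> if the set is unbounded.\<close>

definition gen_inverse :: "(real \<Rightarrow> real) \<Rightarrow> ereal \<Rightarrow> ereal" where
  "gen_inverse \<Phi> y = Sup (ereal ` {t. 0 \<le> t \<and> ereal (\<Phi> t) \<le> y})"

definition transport_entropy ::
  "(real \<Rightarrow> real) \<Rightarrow> (real \<Rightarrow> real) \<Rightarrow> 'a :: metric_space measure \<Rightarrow> bool" where
  "transport_entropy \<phi> \<Phi> \<mu> \<longleftrightarrow>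
    (\<forall>\<nu>. borel_prob \<nu> \<longrightarrow>
      enn2ereal (transport_cost \<phi> \<nu> \<mu>) \<le> gen_inverse \<Phi> (rel_entropy \<nu> \<mu>))"

definition inf_conv ::
  "(real \<Rightarrow> real) \<Rightarrow> ('a :: metric_space \<Rightarrow> real) \<Rightarrow> 'a \<Rightarrow> ereal" where
  "inf_conv \<phi> g x = (INF y. ereal (g y + \<phi> (dist x y)))"

text \<open>For a Borel function \<open>g\<close>, \<open>inf_conv \<phi> g\<close> need not be Borel, but its sublevel sets are
  analytic, so that it is measurable with respect to the completion of \<open>\<mu>\<close>. By
  \<open>nn_integral_completion\<close>, which has no measurability hypothesis, the integral below is the
  one with respect to this completion.\<close>

definition infimum_convolution ::
  "(real \<Rightarrow> real) \<Rightarrow> (real \<Rightarrow> real) \<Rightarrow> 'a :: metric_space measure \<Rightarrow> bool" where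
  "infimum_convolution \<phi> \<Phi> \<mu> \<longleftrightarrow>
    (\<forall>g. integrable \<mu> g \<longrightarrow>
      (\<forall>l>0. (\<integral>\<^sup>+ x. exp_ereal (ereal l * inf_conv \<phi> g x) \<partial>\<mu>)
        \<le> exp_ereal (ereal (l * (\<integral>x. g x \<partial>\<mu>)) + legendre \<Phi> l)))"

definition C_const :: "real \<Rightarrow> real \<Rightarrow> (real \<Rightarrow> real) \<Rightarrow> ennreal" where
  "C_const L p \<Psi> = exp_ereal (legendre \<Psi> (p * L) / ereal p)"

text \<open>A constant comparing the \<open>p\<close>-moment with the \<open>q\<close>-moment for \<open>q < p\<close>: one passes through
  the \<open>0\<close>-moment, and no loss occurs on a side where monotonicity of moments suffices. It is
  written out, instead of being quantified existentially, because it must not depend on the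
  metric space, which is a type.\<close>

definition moment_const :: "real \<Rightarrow> (real \<Rightarrow> real) \<Rightarrow> real \<Rightarrow> real \<Rightarrow> ennreal" where
  "moment_const L \<Psi> p q =
    (if 0 < p then C_const L p \<Psi> else 1) * (if q < 0 then C_const L (- q) \<Psi> else 1)"

definition moments_comparable ::
  "'a measure \<Rightarrow> ('a \<Rightarrow> real) \<Rightarrow> real set \<Rightarrow> (real \<Rightarrow> real \<Rightarrow> ennreal) \<Rightarrow> bool" where
  "moments_comparable M f I K \<longleftrightarrow>
    (\<forall>q\<in>I. \<forall>p\<in>I. q < p \<longrightarrow> K p q < \<infinity> \<and> Lp_moment M p f \<le> K p q * Lp_moment M q f)"

end

theory Submission
  imports Defs
begin

text \<open>For an \<open>s\<close>-Lipschitz \<open>g\<close>, either hypothesis gives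
  \<open>\<integral>exp g d\<mu> \<le> exp (\<integral>g d\<mu> + \<lambda> \<phi>\<^sup>*(s / \<lambda>) + \<Phi>\<^sup>*(\<lambda>))\<close> for every \<open>\<lambda> > 0\<close>, and Lagrange
  duality for the constraint \<open>\<phi> u \<le> t\<close> provides a \<open>\<lambda>\<close> for which the extra terms are at most
  \<open>\<Psi>\<^sup>*(s)\<close>. Bounded \<open>g\<close> come first, as the integrability of \<open>ln f\<close> is not assumed: the bound for
  truncations of \<open>- \<bar>g\<bar>\<close> controls their means and so yields integrability. The moment inequalities are
  the cases \<open>g = p ln f\<close> and \<open>g = - p ln f\<close>; Jensen's inequality handles exponents of equal sign.\<close>

section \<open>Lagrange duality for the Legendre transform of a composition\<close>

lemma legendre_le_iff:
  "legendre \<Theta> s \<le> ereal M \<longleftrightarrow> (\<forall>t>0. s * t - \<Theta> t \<le> M)"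
  unfolding legendre_def by (auto simp: SUP_le_iff)

text \<open>Strong duality for maximizing \<open>s * u - \<Phi> t\<close> subject to
  \<open>\<phi> u \<le> t\<close>. As \<open>\<Phi>\<close> is non-decreasing, the maximum is
  governed by the Legendre transform of the composition. With a multiplier \<open>l\<close>, the
  Lagrangian splits into a function of \<open>u\<close> and a function of \<open>t\<close>;
  \<open>K\<close> is the supremum of the first part.\<close>

lemma legendre_multiplier:
  fixes \<phi> \<Phi> :: "real \<Rightarrow> real"
  assumes \<phi>: "convex_on {0..} \<phi>" "continuous_on {0..} \<phi>" "\<forall>t\<ge>0. 0 \<le> \<phi> t" "\<phi> 0 = 0"
    and \<Phi>: "convex_on {0..} \<Phi>" "mono_on {0..} \<Phi>" "continuous_on {0..} \<Phi>"
    and s: "0 < s" and M: "legendre (\<Phi> \<circ> \<phi>) s \<le> ereal M"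
  obtains l K where "0 < l" "\<And>u. 0 \<le> u \<Longrightarrow> s * u - l * \<phi> u \<le> K"
    "\<And>t. 0 \<le> t \<Longrightarrow> l * t - \<Phi> t \<le> M - K"
proof -
  \<comment> \<open>The supremum in \<open>legendre\<close> runs over positive arguments only;
    continuity extends the bound to \<open>u = 0\<close>.\<close>
  have "continuous_on {0..} (\<Phi> \<circ> \<phi>)"
    unfolding o_def using \<phi>(3) by (intro continuous_on_compose2[OF \<Phi>(3) \<phi>(2)]) auto
  then have cont: "continuous_on (closure {0<..}) (\<lambda>u. s * u - (\<Phi> \<circ> \<phi>) u)"
    by (auto intro!: continuous_intros)
  have le: "s * u - \<Phi> (\<phi> u) \<le> M" if "0 \<le> u" for u
    using continuous_le_on_closure[OF cont, of u M] that M
    by (auto simp: legendre_le_iff)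
  have unbounded: "\<exists>u\<ge>0. b < s * u" for b
    using s by (intro exI[of _ "(\<bar>b\<bar> + 1) / s"]) auto
  \<comment> \<open>\<open>F\<close> is the gap between \<open>M\<close> and the objective,
    \<open>G\<close> is the constraint. A multiplier must make \<open>F + l * G\<close> nonnegative
    everywhere: points with \<open>G > 0\<close> bound \<open>l\<close> from below by
    \<open>- F / G\<close>, points with \<open>G < 0\<close> bound it from above by
    \<open>F / (- G)\<close>. The claim \<open>sep\<close> says that these bounds are
    compatible.\<close>
  define F where "F = (\<lambda>u t. M - s * u + \<Phi> t)"
  define G where "G = (\<lambda>u t. \<phi> u - t)"
  have sep: "- F u1 t1 / G u1 t1 \<le> F u2 t2 / (- G u2 t2)"
    if nn: "0 \<le> u1" "0 \<le> t1" "0 \<le> u2" "0 \<le> t2" and G1: "0 < G u1 t1" and G2: "G u2 t2 < 0"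
    for u1 t1 u2 t2
  proof -
    define d where "d = G u1 t1 - G u2 t2"
    \<comment> \<open>With these weights the average of \<open>G\<close> vanishes. By convexity of
      \<open>\<phi>\<close> the averaged point is then feasible, and \<open>le\<close> applies
      there.\<close>
    define \<alpha> where "\<alpha> = - G u2 t2 / d"
    define \<beta> where "\<beta> = G u1 t1 / d"
    have d: "0 < d" using G1 G2 by (simp add: d_def)
    have ab: "0 \<le> \<alpha>" "0 \<le> \<beta>" using d G1 G2 by (auto simp: \<alpha>_def \<beta>_def divide_nonpos_pos)
    have sum1: "\<alpha> + \<beta> = 1"
      using d unfolding \<alpha>_def \<beta>_def add_divide_distrib[symmetric] by (simp add: d_def)
    have bal: "\<alpha> * G u1 t1 + \<beta> * G u2 t2 = 0" by (simp add: \<alpha>_def \<beta>_def)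
    define u where "u = \<alpha> * u1 + \<beta> * u2"
    define t where "t = \<alpha> * t1 + \<beta> * t2"
    have ut: "0 \<le> u" "0 \<le> t" using nn ab by (auto simp: u_def t_def)
    have "\<phi> u \<le> \<alpha> * \<phi> u1 + \<beta> * \<phi> u2"
      using \<phi>(1) ab sum1 nn unfolding u_def convex_on_def by auto
    also have "\<dots> = t" using bal by (simp add: G_def t_def algebra_simps)
    finally have "\<Phi> (\<phi> u) \<le> \<Phi> t"
      using \<Phi>(2) \<phi>(3) ut by (auto simp: mono_on_def)
    also have "\<dots> \<le> \<alpha> * \<Phi> t1 + \<beta> * \<Phi> t2"
      using \<Phi>(1) ab sum1 nn unfolding t_def convex_on_def by auto
    finally have "0 \<le> (\<alpha> + \<beta>) * M - s * u + \<alpha> * \<Phi> t1 + \<beta> * \<Phi> t2"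
      using le[OF ut(1)] sum1 by simp
    also have "\<dots> = \<alpha> * F u1 t1 + \<beta> * F u2 t2"
      by (simp add: F_def u_def algebra_simps)
    also have "\<dots> = (- G u2 t2 * F u1 t1 + G u1 t1 * F u2 t2) / d"
      by (simp add: \<alpha>_def \<beta>_def add_divide_distrib diff_divide_distrib)
    finally have "0 \<le> - G u2 t2 * F u1 t1 + G u1 t1 * F u2 t2"
      using d by (simp add: zero_le_divide_iff)
    then show ?thesis using G1 G2 by (simp add: field_simps)
  qed
  define A where "A = {- F u t / G u t | u t. 0 \<le> u \<and> 0 \<le> t \<and> 0 < G u t}"
  \<comment> \<open>By \<open>le\<close>, so large a \<open>u0\<close> cannot have
    \<open>\<phi> u0 = 0\<close>. Hence \<open>(u0, 0)\<close> violates the constraint, which makes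
    \<open>A\<close> nonempty; the same point later forces \<open>l\<close> to be positive.\<close>
  obtain u0 where u0: "0 \<le> u0" "M + \<Phi> 0 < s * u0" using unbounded by blast
  then have "\<phi> u0 \<noteq> 0" using le[of u0] by auto
  then have "0 < G u0 0" using \<phi>(3) u0(1) by (auto simp: G_def less_le)
  then have A_ne: "A \<noteq> {}" using u0(1) by (auto simp: A_def)
  have A_le: "a \<le> F u t / (- G u t)" if "a \<in> A" "0 \<le> u" "0 \<le> t" "G u t < 0" for a u t
    using that sep by (auto simp: A_def)
  \<comment> \<open>The Slater condition: a strictly feasible point bounds all elements of
    \<open>A\<close> from above.\<close>
  have "G 0 1 < 0" using \<phi>(4) by (simp add: G_def)
  then have A_bdd: "bdd_above A" using A_le[of _ 0 1] by (auto intro!: bdd_aboveI)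
  define l where "l = Sup A"
  have lag: "0 \<le> F u t + l * G u t" if "0 \<le> u" "0 \<le> t" for u t
  proof (cases "G u t" "0 :: real" rule: linorder_cases)
    case less
    then have "l \<le> F u t / (- G u t)"
      unfolding l_def using A_le that by (intro cSup_least[OF A_ne]) auto
    with less show ?thesis by (simp add: field_simps)
  next
    case equal
    then show ?thesis using le[OF that(1)] by (simp add: F_def G_def)
  next
    case greater
    then have "- F u t / G u t \<le> l"
      unfolding l_def using that by (intro cSup_upper[OF _ A_bdd]) (auto simp: A_def)
    with greater show ?thesis by (simp add: field_simps)
  qed
  have lag': "s * u - l * \<phi> u \<le> M - (l * t - \<Phi> t)" if "0 \<le> u" "0 \<le> t" for u t
    using lag[OF that] by (simp add: F_def G_def algebra_simps)
  have "0 < l"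
  proof (rule ccontr)
    assume "\<not> 0 < l"
    then have "l * \<phi> u0 \<le> 0" using \<phi>(3) u0(1) by (simp add: mult_nonpos_nonneg)
    then show False using lag'[of u0 0] u0 by simp
  qed
  define K where "K = (SUP u\<in>{0..}. s * u - l * \<phi> u)"
  have bdd: "bdd_above ((\<lambda>u. s * u - l * \<phi> u) ` {0..})"
    using lag'[of _ 0] by (auto intro!: bdd_aboveI2)
  show thesis
  proof (rule that)
    show "s * u - l * \<phi> u \<le> K" if "0 \<le> u" for u
      unfolding K_def using bdd that by (intro cSUP_upper) auto
    show "l * t - \<Phi> t \<le> M - K" if "0 \<le> t" for t
    proof -
      have "K \<le> M - (l * t - \<Phi> t)"
        unfolding K_def using lag' that by (intro cSUP_least) auto
      then show ?thesis by simp
    qed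
  qed fact
qed

section \<open>Integrals with respect to Borel probability measures\<close>

lemma exp_ereal_mono: "x \<le> y \<Longrightarrow> exp_ereal x \<le> exp_ereal y"
  by (cases x; cases y) (auto simp: exp_ereal_def)

lemma borel_probD:
  assumes "borel_prob M"
  shows "prob_space M" "sets M = sets borel" "space M = UNIV"
  using assms sets_eq_imp_space_eq[of M borel] by (auto simp: borel_prob_def)

lemma ext_integral_eq_integral:
  assumes "integrable M g"
  shows "ext_integral M g = ereal (integral\<^sup>L M g)"
proof -
  have fin: "(\<integral>\<^sup>+ x. ennreal (g x) \<partial>M) < \<infinity>" "(\<integral>\<^sup>+ x. ennreal (- g x) \<partial>M) < \<infinity>"
    using assms by (auto simp: real_integrable_def less_top)
  then obtain a b where "0 \<le> a" "(\<integral>\<^sup>+ x. ennreal (g x) \<partial>M) = ennreal a"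
    "0 \<le> b" "(\<integral>\<^sup>+ x. ennreal (- g x) \<partial>M) = ennreal b"
    by (metis ennreal_cases less_irrefl infinity_ennreal_def)
  then show ?thesis
    unfolding ext_integral_def real_lebesgue_integral_def[OF assms]
    by (simp add: enn2ereal_ennreal)
qed

text \<open>Jensen's inequality, obtained by integrating the tangent line of \<open>exp\<close> at
  the mean of \<open>g\<close>. The nonnegative integral on the right covers the case of an infinite
  exponential moment.\<close>

lemma (in prob_space) exp_integral_le:
  fixes g :: "'a \<Rightarrow> real"
  assumes "integrable M g"
  shows "ennreal (exp (integral\<^sup>L M g)) \<le> (\<integral>\<^sup>+ x. ennreal (exp (g x)) \<partial>M)"
proof -
  define m where "m = integral\<^sup>L M g"
  show ?thesis
  proof (cases "(\<integral>\<^sup>+ x. ennreal (exp (g x)) \<partial>M) = \<infinity>")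
    case False
    have [measurable]: "g \<in> borel_measurable M" using assms by simp
    have int: "integrable M (\<lambda>x. exp (g x))"
      using False by (intro integrableI_nonneg) (auto simp: less_top)
    have "exp m * (1 + (g x - m)) \<le> exp (g x)" for x
      using mult_left_mono[OF exp_ge_add_one_self[of "g x - m"], of "exp m"]
      by (simp add: mult_exp_exp)
    then have "(\<integral>x. exp m * (1 + (g x - m)) \<partial>M) \<le> (\<integral>x. exp (g x) \<partial>M)"
      using assms int by (intro integral_mono) auto
    then have "exp m \<le> (\<integral>x. exp (g x) \<partial>M)"
      using assms by (simp add: m_def prob_space)
    then show ?thesis
      using int by (simp add: m_def nn_integral_eq_integral)
  qed simp
qed

lemma integrable_lipschitz_bounded:
  fixes g :: "'a::metric_space \<Rightarrow> real"
  assumes M: "borel_prob M" and "s-lipschitz_on UNIV g" "\<And>x. \<bar>g x\<bar> \<le> B"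
  shows "integrable M g" "integrable M (\<lambda>x. exp (g x))"
proof -
  interpret prob_space M using M by (rule borel_probD)
  have "continuous_on UNIV g" using assms(2) by (rule lipschitz_on_continuous_on)
  then have "g \<in> borel_measurable borel" by (rule borel_measurable_continuous_onI)
  then have [measurable]: "g \<in> borel_measurable M"
    using measurable_cong_sets[OF borel_probD(2)[OF M] refl] by blast
  show "integrable M g"
    using assms(3) by (intro integrable_const_bound[of _ B]) auto
  have "norm (exp (g x)) \<le> exp B" for x
    using assms(3)[of x] by simp
  then show "integrable M (\<lambda>x. exp (g x))"
    by (intro integrable_const_bound[of _ "exp B"]) auto
qed

section \<open>Exponential bounds for bounded Lipschitz functions\<close>

text \<open>The inequality is applied to \<open>g / l\<close> with parameter \<open>l\<close>.
  Infimum convolution lowers \<open>g / l\<close> by at most \<open>K / l\<close>, and the Legendre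
  transform of \<open>\<Phi>\<close> at \<open>l\<close> is at most \<open>M - K\<close>, so that
  \<open>K\<close> cancels.\<close>

lemma exp_mean_infimum_convolution:
  fixes \<mu> :: "'a::metric_space measure" and g :: "'a \<Rightarrow> real"
  assumes \<mu>: "borel_prob \<mu>" and ic: "infimum_convolution \<phi> \<Phi> \<mu>"
    and l: "0 < l" and K: "\<And>u. 0 \<le> u \<Longrightarrow> s * u - l * \<phi> u \<le> K"
    and MK: "\<And>t. 0 \<le> t \<Longrightarrow> l * t - \<Phi> t \<le> M - K"
    and g: "s-lipschitz_on UNIV g" "\<And>x. \<bar>g x\<bar> \<le> B"
  shows "(\<integral>x. exp (g x) \<partial>\<mu>) \<le> exp (integral\<^sup>L \<mu> g + M)"
proof -
  interpret prob_space \<mu> using \<mu> by (rule borel_probD)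
  note int = integrable_lipschitz_bounded[OF \<mu> g]
  have pw: "ennreal (exp (g x - K)) \<le> exp_ereal (ereal l * inf_conv \<phi> (\<lambda>x. g x / l) x)" for x
  proof -
    have "ereal ((g x - K) / l) \<le> inf_conv \<phi> (\<lambda>x. g x / l) x"
      unfolding inf_conv_def
    proof (rule INF_greatest)
      fix y
      have "g x - g y \<le> s * dist x y"
        using lipschitz_onD[OF g(1), of x y] by (simp add: dist_real_def)
      moreover have "s * dist x y - l * \<phi> (dist x y) \<le> K" by (rule K) simp
      moreover have "l * (g y / l + \<phi> (dist x y)) = g y + l * \<phi> (dist x y)"
        using l by (simp add: distrib_left)
      ultimately have "g x - K \<le> l * (g y / l + \<phi> (dist x y))"
        by linarith
      then show "ereal ((g x - K) / l) \<le> ereal (g y / l + \<phi> (dist x y))"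
        using l by (simp add: pos_divide_le_eq mult.commute)
    qed
    then have "ereal l * ereal ((g x - K) / l) \<le> ereal l * inf_conv \<phi> (\<lambda>x. g x / l) x"
      using l by (intro ereal_mult_left_mono) auto
    from exp_ereal_mono[OF this] show ?thesis
      using l by (simp add: exp_ereal_def)
  qed
  have "ennreal (\<integral>x. exp (g x - K) \<partial>\<mu>) = (\<integral>\<^sup>+ x. ennreal (exp (g x - K)) \<partial>\<mu>)"
    using int(2) by (subst nn_integral_eq_integral) (auto simp: exp_diff)
  \<comment> \<open>The integrand on the right may fail to be Borel; monotonicity of the nonnegative
    integral holds for arbitrary functions.\<close>
  also have "\<dots> \<le> (\<integral>\<^sup>+ x. exp_ereal (ereal l * inf_conv \<phi> (\<lambda>x. g x / l) x) \<partial>\<mu>)"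
    by (intro nn_integral_mono pw)
  also have "\<dots> \<le> exp_ereal (ereal (l * (\<integral>x. g x / l \<partial>\<mu>)) + legendre \<Phi> l)"
    using ic[unfolded infimum_convolution_def, rule_format, of "\<lambda>x. g x / l" l] int(1) l
    by (simp del: integral_divide)
  also have "l * (\<integral>x. g x / l \<partial>\<mu>) = integral\<^sup>L \<mu> g"
    using l by simp
  also have "exp_ereal (ereal (integral\<^sup>L \<mu> g) + legendre \<Phi> l) \<le> exp_ereal (ereal (integral\<^sup>L \<mu> g) + ereal (M - K))"
    using l MK by (intro exp_ereal_mono add_mono) (auto simp: legendre_le_iff)
  finally have "ennreal (\<integral>x. exp (g x - K) \<partial>\<mu>) \<le> ennreal (exp (integral\<^sup>L \<mu> g + (M - K)))"
    by (simp add: exp_ereal_def)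
  then show ?thesis
    by (simp add: exp_diff exp_add divide_le_cancel)
qed

text \<open>\<open>RN_deriv\<close> agrees with \<open>h\<close> almost everywhere with respect to
  \<open>\<mu>\<close>, hence also with respect to the density, against which the entropy
  integrates.\<close>

lemma rel_entropy_density:
  fixes \<mu> :: "'a measure"
  assumes "prob_space \<mu>" and h: "h \<in> borel_measurable \<mu>" "\<And>x. 0 < h x"
    and int: "integrable (density \<mu> h) (\<lambda>x. ln (h x))"
  shows "rel_entropy (density \<mu> h) \<mu> = ereal (\<integral>x. ln (h x) \<partial>density \<mu> h)"
proof -
  interpret prob_space \<mu> by fact
  note h(1)[measurable]
  have ac: "absolutely_continuous \<mu> (density \<mu> h)"
    by (intro absolutely_continuousI_density) auto
  have "AE x in \<mu>. ennreal (h x) = RN_deriv \<mu> (density \<mu> h) x"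
    by (intro RN_deriv_unique) auto
  then have "AE x in \<mu>. enn2real (RN_deriv \<mu> (density \<mu> h) x) = h x"
    by eventually_elim (metis enn2real_ennreal h(2) less_imp_le)
  then have ae: "AE x in density \<mu> h.
      ln (enn2real (RN_deriv \<mu> (density \<mu> h) x)) = ln (h x)"
    by (subst AE_density) auto
  have "integrable (density \<mu> h) (\<lambda>x. ln (enn2real (RN_deriv \<mu> (density \<mu> h) x)))"
    using int ae by (subst integrable_cong_AE[OF _ _ ae]) auto
  moreover have "(\<integral>x. ln (enn2real (RN_deriv \<mu> (density \<mu> h) x)) \<partial>density \<mu> h) =
      (\<integral>x. ln (h x) \<partial>density \<mu> h)"
    by (intro integral_cong_AE ae) auto
  ultimately show ?thesis
    by (simp add: rel_entropy_def ac ext_integral_eq_integral)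
qed

text \<open>The easy half of Kantorovich duality: under any coupling,
  \<open>g (fst z) - g (snd z) - K\<close> is at most \<open>l\<close> times the cost, and the
  marginals turn its integral into a difference of means.\<close>

lemma transport_cost_ge:
  fixes \<mu> :: "'a::{metric_space,second_countable_topology} measure"
  assumes l: "0 < l" and K: "\<And>u. 0 \<le> u \<Longrightarrow> s * u - l * \<phi> u \<le> K"
    and \<phi>: "continuous_on {0..} \<phi>" "\<forall>t\<ge>0. 0 \<le> \<phi> t"
    and g: "s-lipschitz_on UNIV g" "\<And>x. \<bar>g x\<bar> \<le> B"
  shows "ennreal ((integral\<^sup>L \<nu> g - integral\<^sup>L \<mu> g - K) / l) \<le> transport_cost \<phi> \<nu> \<mu>"
  unfolding transport_cost_def
proof (rule INF_greatest)
  fix P assume P: "P \<in> couplings \<nu> \<mu>"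
  then have bp: "borel_prob P" and marg: "distr P borel fst = \<nu>" "distr P borel snd = \<mu>"
    by (auto simp: couplings_def)
  interpret prob_space P using bp by (rule borel_probD)
  \<comment> \<open>Second countability identifies the Borel sets of the product with the product
    sigma-algebra.\<close>
  have mP[measurable_cong]: "sets P = sets (borel \<Otimes>\<^sub>M borel)"
    unfolding borel_prod by (rule borel_probD(2)[OF bp])
  have "continuous_on UNIV g" using g(1) by (rule lipschitz_on_continuous_on)
  then have [measurable]: "g \<in> borel_measurable borel" by (rule borel_measurable_continuous_onI)
  let ?c = "\<lambda>z :: 'a \<times> 'a. \<phi> (dist (fst z) (snd z))"
  have "continuous_on UNIV ?c"
    by (intro continuous_on_compose2[OF \<phi>(1)] continuous_intros) auto
  then have "?c \<in> borel_measurable borel" by (rule borel_measurable_continuous_onI)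
  then have [measurable]: "?c \<in> borel_measurable P"
    using measurable_cong_sets[OF borel_probD(2)[OF bp] refl] by blast
  show "ennreal ((integral\<^sup>L \<nu> g - integral\<^sup>L \<mu> g - K) / l) \<le> (\<integral>\<^sup>+ z. ennreal (?c z) \<partial>P)"
  proof (cases "(\<integral>\<^sup>+ z. ennreal (?c z) \<partial>P) = \<infinity>")
    case False
    then have c: "integrable P ?c"
      using \<phi>(2) by (intro integrableI_nonneg) (auto simp: less_top)
    have i: "integrable P (\<lambda>z. g (fst z))" "integrable P (\<lambda>z. g (snd z))"
      using g(2) by (auto intro!: integrable_const_bound[of _ B])
    have "integral\<^sup>L \<nu> g - integral\<^sup>L \<mu> g - K = (\<integral>z. g (fst z) - g (snd z) - K \<partial>P)"
      using i by (simp add: integral_distr prob_space flip: marg)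
    also have "\<dots> \<le> (\<integral>z. l * ?c z \<partial>P)"
    proof (rule integral_mono)
      fix z :: "'a \<times> 'a"
      have "g (fst z) - g (snd z) \<le> s * dist (fst z) (snd z)"
        using lipschitz_onD[OF g(1), of "fst z" "snd z"] by (simp add: dist_real_def)
      moreover have "s * dist (fst z) (snd z) - l * ?c z \<le> K" by (rule K) simp
      ultimately show "g (fst z) - g (snd z) - K \<le> l * ?c z" by simp
    qed (use i c in auto)
    finally have "(integral\<^sup>L \<nu> g - integral\<^sup>L \<mu> g - K) / l \<le> (\<integral>z. ?c z \<partial>P)"
      using l by (simp add: field_simps)
    then show ?thesis
      using c \<phi>(2) by (subst nn_integral_eq_integral) (auto intro!: ennreal_leI)
  qed simp
qed

text \<open>The inequality is applied to the Gibbs measure \<open>exp g / Z\<close>, the optimizer in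
  \<open>ln Z = sup (\<integral>g d\<nu> - H(\<nu>|\<mu>))\<close>.\<close>

lemma exp_mean_transport_entropy:
  fixes \<mu> :: "'a::{metric_space,second_countable_topology} measure" and g :: "'a \<Rightarrow> real"
  assumes \<mu>: "borel_prob \<mu>" and te: "transport_entropy \<phi> \<Phi> \<mu>"
    and l: "0 < l" and K: "\<And>u. 0 \<le> u \<Longrightarrow> s * u - l * \<phi> u \<le> K"
    and MK: "\<And>t. 0 \<le> t \<Longrightarrow> l * t - \<Phi> t \<le> M - K"
    and \<phi>: "continuous_on {0..} \<phi>" "\<forall>t\<ge>0. 0 \<le> \<phi> t"
    and g: "s-lipschitz_on UNIV g" "\<And>x. \<bar>g x\<bar> \<le> B"
  shows "(\<integral>x. exp (g x) \<partial>\<mu>) \<le> exp (integral\<^sup>L \<mu> g + M)"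
proof -
  interpret prob_space \<mu> using \<mu> by (rule borel_probD)
  note int = integrable_lipschitz_bounded[OF \<mu> g]
  have [measurable]: "g \<in> borel_measurable \<mu>" using int(1) by simp
  define Z where "Z = (\<integral>x. exp (g x) \<partial>\<mu>)"
  have "ennreal (exp (integral\<^sup>L \<mu> g)) \<le> ennreal Z"
    using exp_integral_le[OF int(1)] int(2) by (simp add: Z_def nn_integral_eq_integral)
  then have "exp (integral\<^sup>L \<mu> g) \<le> Z" by (simp add: Z_def)
  then have Z: "0 < Z" using exp_gt_zero less_le_trans by blast
  define h where "h = (\<lambda>x. exp (g x) / Z)"
  have h: "h \<in> borel_measurable \<mu>" "\<And>x. 0 < h x" using Z by (auto simp: h_def)
  have ln_h: "ln (h x) = g x - ln Z" for x
    using Z by (simp add: h_def ln_div)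
  define \<nu> where "\<nu> = density \<mu> h"
  have "emeasure \<nu> (space \<nu>) = 1"
    using Z int(2) by (simp add: \<nu>_def emeasure_density h nn_integral_eq_integral h_def
        Z_def[symmetric] cong: nn_integral_cong_simp)
  then have \<nu>: "borel_prob \<nu>"
    using borel_probD(2)[OF \<mu>] by (auto simp: borel_prob_def \<nu>_def intro: prob_spaceI)
  interpret \<nu>: prob_space \<nu> using \<nu> by (rule borel_probD)
  note int\<nu> = integrable_lipschitz_bounded[OF \<nu> g]
  define H where "H = integral\<^sup>L \<nu> g - ln Z"
  have "rel_entropy \<nu> \<mu> = ereal (\<integral>x. ln (h x) \<partial>\<nu>)"
    unfolding \<nu>_def using int\<nu>(1)
    by (intro rel_entropy_density h prob_space_axioms) (auto simp: ln_h \<nu>_def[symmetric])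
  also have "\<dots> = ereal H"
    using int\<nu>(1) by (simp add: ln_h H_def \<nu>.prob_space)
  finally have ent: "rel_entropy \<nu> \<mu> = ereal H" .
  define w where "w = (integral\<^sup>L \<nu> g - integral\<^sup>L \<mu> g - K) / l"
  \<comment> \<open>\<open>ennreal\<close> sends a negative \<open>w\<close> to \<open>0\<close>,
    hence an inequality.\<close>
  have "ereal w \<le> enn2ereal (ennreal w)"
    by (cases "0 \<le> w") (auto simp: enn2ereal_ennreal ennreal_neg zero_ennreal.rep_eq)
  also have "\<dots> \<le> enn2ereal (transport_cost \<phi> \<nu> \<mu>)"
    using transport_cost_ge[OF l K \<phi> g, of \<nu> \<mu>] by (simp add: w_def less_eq_ennreal.rep_eq)
  also have "\<dots> \<le> gen_inverse \<Phi> (ereal H)"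
    using te \<nu> unfolding transport_entropy_def ent[symmetric] by blast
  \<comment> \<open>By \<open>MK\<close>, each \<open>t\<close> with \<open>\<Phi> t \<le> H\<close>
    satisfies \<open>l * t \<le> H + M - K\<close>. If there is no such \<open>t\<close>, the
    supremum is \<open>- \<infinity>\<close> and the bound still holds.\<close>
  also have "\<dots> \<le> ereal ((H + M - K) / l)"
    unfolding gen_inverse_def
  proof (safe intro!: Sup_least)
    fix t assume "0 \<le> t" "ereal (\<Phi> t) \<le> ereal H"
    with MK[of t] l show "ereal t \<le> ereal ((H + M - K) / l)"
      by (simp add: pos_le_divide_eq mult.commute)
  qed
  \<comment> \<open>The mean under \<open>\<nu>\<close> and the constant \<open>K\<close> occur on
    both sides and cancel.\<close>
  finally have "ln Z \<le> integral\<^sup>L \<mu> g + M"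
    using l by (simp add: w_def H_def divide_le_cancel)
  then have "exp (ln Z) \<le> exp (integral\<^sup>L \<mu> g + M)" by simp
  then show ?thesis
    using Z by (simp add: Z_def[symmetric])
qed

section \<open>From bounded to general Lipschitz functions\<close>

text \<open>Fatou's lemma, in the form that carries bounds for truncations to the limit.\<close>

lemma nn_integral_le_limit:
  fixes u :: "nat \<Rightarrow> 'a \<Rightarrow> real"
  assumes "\<And>n. u n \<in> borel_measurable M" "\<And>x. (\<lambda>n. u n x) \<longlonglongrightarrow> v x"
    and le: "\<And>n. (\<integral>\<^sup>+ x. ennreal (u n x) \<partial>M) \<le> ennreal (c n)" and c: "c \<longlonglongrightarrow> b"
  shows "(\<integral>\<^sup>+ x. ennreal (v x) \<partial>M) \<le> ennreal b"
proof -
  have "ennreal (v x) = liminf (\<lambda>n. ennreal (u n x))" for x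
    using assms(2) by (intro lim_imp_Liminf[symmetric] tendsto_ennrealI) auto
  then have "(\<integral>\<^sup>+ x. ennreal (v x) \<partial>M) = (\<integral>\<^sup>+ x. liminf (\<lambda>n. ennreal (u n x)) \<partial>M)" by simp
  also have "\<dots> \<le> liminf (\<lambda>n. \<integral>\<^sup>+ x. ennreal (u n x) \<partial>M)"
    using assms(1) by (intro nn_integral_liminf) auto
  also have "\<dots> \<le> liminf (\<lambda>n. ennreal (c n))"
    by (intro Liminf_mono always_eventually allI le)
  also have "\<dots> = ennreal b"
    using c by (intro lim_imp_Liminf tendsto_ennrealI) auto
  finally show ?thesis .
qed

text \<open>The estimate for bounded functions enters as the hypothesis \<open>bounded\<close>, so
  that one limit argument serves both forms of the inequality.\<close>

lemma lipschitz_exp_moment: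
  fixes g :: "'a::metric_space \<Rightarrow> real"
  assumes \<mu>: "borel_prob \<mu>"
    and bounded: "\<And>g B. s-lipschitz_on UNIV g \<Longrightarrow> (\<And>x. \<bar>g x\<bar> \<le> B) \<Longrightarrow>
      (\<integral>x. exp (g x) \<partial>\<mu>) \<le> exp (integral\<^sup>L \<mu> g + M)"
    and g: "s-lipschitz_on UNIV g"
  shows "integrable \<mu> g" "(\<integral>\<^sup>+ x. ennreal (exp (g x)) \<partial>\<mu>) \<le> ennreal (exp (integral\<^sup>L \<mu> g + M))"
proof -
  interpret prob_space \<mu> using \<mu> by (rule borel_probD)
  have "continuous_on UNIV g" using g by (rule lipschitz_on_continuous_on)
  then have "g \<in> borel_measurable borel" by (rule borel_measurable_continuous_onI)
  then have [measurable]: "g \<in> borel_measurable \<mu>"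
    using measurable_cong_sets[OF borel_probD(2)[OF \<mu>] refl] by blast
  have g_dist: "\<bar>g x - g y\<bar> \<le> s * dist x y" for x y
    using lipschitz_onD[OF g, of x y] by (simp add: dist_real_def)
  have s: "0 \<le> s" using g by (rule lipschitz_on_nonneg)
  have ev_eq: "(\<lambda>n. min a (real n)) \<longlonglongrightarrow> a" for a
  proof (rule tendsto_eventually)
    show "\<forall>\<^sub>F n in sequentially. min a (real n) = a"
      using eventually_ge_at_top[of "nat \<lceil>a\<rceil>"] by eventually_elim (simp add: min_def; linarith)
  qed

  define k where "k = (\<lambda>n x. min \<bar>g x\<bar> (real n))"
  have k_int: "integrable \<mu> (k n)" for n
    unfolding k_def by (intro integrable_const_bound[of _ "real n"]) auto
  have k_lim: "(\<lambda>n. k n x) \<longlonglongrightarrow> \<bar>g x\<bar>" for x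
    unfolding k_def by (rule ev_eq)
  have k_lip: "s-lipschitz_on UNIV (\<lambda>x. - k n x)" for n
  proof (rule lipschitz_onI[OF _ s])
    fix x y show "dist (- k n x) (- k n y) \<le> s * dist x y"
      using g_dist[of x y] unfolding k_def dist_real_def by linarith
  qed
  \<comment> \<open>Since \<open>- k n x\<close> is at least \<open>- \<bar>g x\<bar>\<close>, the
    positive number \<open>c\<close> is a lower bound, independent of \<open>n\<close>, for the
    exponential means of all truncations. Then \<open>bounded\<close> keeps the mean of
    \<open>k n\<close> below \<open>M - ln c\<close>.\<close>
  define c where "c = (\<integral>x. exp (- \<bar>g x\<bar>) \<partial>\<mu>)"
  have c_int: "integrable \<mu> (\<lambda>x. exp (- \<bar>g x\<bar>))"
    by (intro integrable_const_bound[of _ 1]) auto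
  have "c \<noteq> 0"
  proof
    assume "c = 0"
    then have "AE x in \<mu>. exp (- \<bar>g x\<bar>) = 0"
      unfolding c_def using c_int by (subst (asm) integral_nonneg_eq_0_iff_AE) auto
    then show False by simp
  qed
  then have c: "0 < c" by (auto simp: c_def less_le)
  have k_le: "integral\<^sup>L \<mu> (k n) \<le> M - ln c" for n
  proof -
    have bd: "\<bar>- k n x\<bar> \<le> real n" for x by (simp add: k_def)
    have "c \<le> (\<integral>x. exp (- k n x) \<partial>\<mu>)"
      unfolding c_def using integrable_lipschitz_bounded(2)[OF \<mu> k_lip bd]
      by (intro integral_mono c_int) (auto simp: k_def)
    also have "\<dots> \<le> exp (M - integral\<^sup>L \<mu> (k n))"
      using bounded[OF k_lip bd] by simp
    finally have "ln c \<le> M - integral\<^sup>L \<mu> (k n)"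
      using c ln_le_cancel_iff[of c "exp (M - integral\<^sup>L \<mu> (k n))"] by simp
    then show ?thesis by simp
  qed
  have "(\<integral>\<^sup>+ x. ennreal (k n x) \<partial>\<mu>) \<le> ennreal (M - ln c)" for n
    using k_le[of n] by (subst nn_integral_eq_integral[OF k_int]) (auto simp: k_def intro: ennreal_leI)
  then have "(\<integral>\<^sup>+ x. ennreal \<bar>g x\<bar> \<partial>\<mu>) \<le> ennreal (M - ln c)"
    by (rule nn_integral_le_limit[OF _ k_lim _ tendsto_const, rotated]) (use k_int in auto)
  then show int: "integrable \<mu> g"
    by (intro integrableI_bounded) (auto simp: less_top[symmetric] top_unique)

  \<comment> \<open>Now that \<open>g\<close> is integrable, it is truncated on both sides:
    dominated convergence handles the means, Fatou's lemma the exponentials.\<close>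
  define t where "t = (\<lambda>n x. max (- real n) (min (g x) (real n)))"
  have t_bd: "\<bar>t n x\<bar> \<le> real n" for n x by (auto simp: t_def)
  have t_meas [measurable]: "t n \<in> borel_measurable \<mu>" for n by (simp add: t_def)
  have t_lim: "(\<lambda>n. t n x) \<longlonglongrightarrow> g x" for x
  proof (rule tendsto_eventually)
    show "\<forall>\<^sub>F n in sequentially. t n x = g x"
      using eventually_ge_at_top[of "nat \<lceil>\<bar>g x\<bar>\<rceil>"]
      by eventually_elim (simp add: t_def min_def max_def; linarith)
  qed
  have t_lip: "s-lipschitz_on UNIV (t n)" for n
  proof (rule lipschitz_onI[OF _ s])
    fix x y show "dist (t n x) (t n y) \<le> s * dist x y"
      using g_dist[of x y] unfolding t_def dist_real_def by linarith
  qed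
  have t_le: "(\<integral>\<^sup>+ x. ennreal (exp (t n x)) \<partial>\<mu>) \<le> ennreal (exp (integral\<^sup>L \<mu> (t n) + M))" for n
    using bounded[OF t_lip t_bd, of n] integrable_lipschitz_bounded(2)[OF \<mu> t_lip t_bd, of n]
    by (subst nn_integral_eq_integral) (auto intro: ennreal_leI)
  have "(\<lambda>n. integral\<^sup>L \<mu> (t n)) \<longlonglongrightarrow> integral\<^sup>L \<mu> g"
    using t_lim int
    by (intro integral_dominated_convergence[where w = "\<lambda>x. \<bar>g x\<bar>"]) (auto simp: t_def)
  then show "(\<integral>\<^sup>+ x. ennreal (exp (g x)) \<partial>\<mu>) \<le> ennreal (exp (integral\<^sup>L \<mu> g + M))"
    by (intro nn_integral_le_limit[OF _ _ t_le]) (auto intro!: tendsto_intros t_lim)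
qed

section \<open>Moments and the constants comparing them\<close>

text \<open>\<open>r\<close> is the gap in Jensen's inequality for \<open>p * ln (f x)\<close>,
  taken on the logarithmic scale. An exact formula serves both signs of \<open>p\<close>:
  \<open>r / p\<close> has the sign of \<open>p\<close> when nonzero, which also contains the
  comparison with the \<open>0\<close>-moment.\<close>

lemma Lp_moment_eq_exp:
  assumes "prob_space \<mu>" and f: "\<And>x. 0 < f x" and int: "integrable \<mu> (\<lambda>x. ln (f x))"
    and p: "p \<noteq> 0"
    and le: "(\<integral>\<^sup>+ x. ennreal (exp (p * ln (f x))) \<partial>\<mu>) \<le> ennreal (exp (p * (\<integral>x. ln (f x) \<partial>\<mu>) + K))"
  obtains r where "0 \<le> r" "r \<le> K" "Lp_moment \<mu> p f = ennreal (exp ((\<integral>x. ln (f x) \<partial>\<mu>) + r / p))"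
proof -
  interpret prob_space \<mu> by fact
  define m where "m = (\<integral>x. ln (f x) \<partial>\<mu>)"
  define I where "I = (\<integral>\<^sup>+ x. ennreal (exp (p * ln (f x))) \<partial>\<mu>)"
  have ge: "ennreal (exp (p * m)) \<le> I"
    using exp_integral_le[of "\<lambda>x. p * ln (f x)"] int by (simp add: I_def m_def)
  have "I \<noteq> \<infinity>" using le by (auto simp: I_def top_unique)
  then obtain i where i: "0 \<le> i" "I = ennreal i" by (cases I) auto
  then have bnd: "exp (p * m) \<le> i" "i \<le> exp (p * m + K)"
    using ge le by (auto simp: I_def m_def)
  then have "0 < i" using exp_gt_zero less_le_trans by blast
  define r where "r = ln i - p * m"
  have "p * m \<le> ln i" "ln i \<le> p * m + K"
    using bnd \<open>0 < i\<close> ln_mono[of "exp (p * m)" i] ln_mono[of i "exp (p * m + K)"] by auto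
  then have r: "0 \<le> r" "r \<le> K" by (auto simp: r_def)
  have "(\<integral>\<^sup>+ x. ennreal (f x powr p) \<partial>\<mu>) = I"
    unfolding I_def using f by (intro nn_integral_cong) (simp add: powr_def less_imp_neq[symmetric])
  then have "Lp_moment \<mu> p f = ennreal (i powr (1 / p))"
    using p i \<open>0 < i\<close> by (simp add: Lp_moment_def powr_ennreal_def)
  also have "i powr (1 / p) = exp (m + r / p)"
    using \<open>0 < i\<close> p by (simp add: powr_def r_def field_simps)
  finally show thesis using r that by (simp add: m_def)
qed

text \<open>The finite term at \<open>t = 1\<close> rules out the value
  \<open>- \<infinity>\<close>.\<close>

lemma legendre_cases:
  obtains "legendre \<Theta> s = \<infinity>" | K where "legendre \<Theta> s = ereal K"
proof -
  have "ereal (s * 1 - \<Theta> 1) \<le> legendre \<Theta> s"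
    unfolding legendre_def by (intro SUP_upper) auto
  then show thesis using that by (cases "legendre \<Theta> s") auto
qed

lemma C_const_eq:
  assumes "0 < p"
  shows "legendre \<Psi> (p * L) = \<infinity> \<Longrightarrow> C_const L p \<Psi> = \<infinity>"
    and "legendre \<Psi> (p * L) = ereal K \<Longrightarrow> C_const L p \<Psi> = ennreal (exp (K / p))"
  using assms by (auto simp: C_const_def exp_ereal_def)

text \<open>By convexity the difference quotients at \<open>0\<close> increase to their supremum
  \<open>S\<close>. If \<open>s\<close> lies below \<open>S\<close>, some quotient
  \<open>h b\<close> exceeds \<open>s\<close>; this controls \<open>s * t - \<Psi> t\<close> for
  \<open>t \<ge> b\<close>, and monotonicity of \<open>\<Psi>\<close> controls it for smaller
  \<open>t\<close>.\<close>

lemma convex_slope_limit: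
  fixes \<Psi> :: "real \<Rightarrow> real"
  assumes cvx: "convex_on {0..} \<Psi>" and mono: "mono_on {0..} \<Psi>"
  obtains S :: ereal where "0 \<le> S" "((\<lambda>t. ereal (\<Psi> t / t)) \<longlongrightarrow> S) at_top"
    "\<And>s. ereal s < S \<Longrightarrow> legendre \<Psi> s < \<infinity>"
proof -
  \<comment> \<open>The value at \<open>0\<close> is subtracted because \<open>\<Psi> t / t\<close>
    itself need not be monotone; the difference \<open>\<Psi> 0 / t\<close> vanishes in the
    limit.\<close>
  define h where "h = (\<lambda>t. (\<Psi> t - \<Psi> 0) / t)"
  define S where "S = (SUP t\<in>{0<..}. ereal (h t))"
  have h_mono: "h a \<le> h b" if "0 < a" "a \<le> b" for a b
  proof -
    have "\<Psi> a \<le> (1 - a / b) * \<Psi> 0 + a / b * \<Psi> b"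
      using convex_onD[OF cvx, of "a / b" 0 b] that by simp
    then show ?thesis using that by (simp add: h_def field_simps)
  qed
  have h_nonneg: "0 \<le> h t" if "0 < t" for t
    using mono that by (auto simp: h_def mono_on_def)
  have h_le_S: "ereal (h t) \<le> S" if "0 < t" for t
    unfolding S_def using that by (intro SUP_upper) auto
  have "0 \<le> S"
    using h_le_S[of 1] h_nonneg[of 1] order_trans[of 0 "ereal (h 1)" S] by simp
  have h_lim: "((\<lambda>t. ereal (h t)) \<longlongrightarrow> S) at_top"
  proof (rule order_tendstoI)
    fix a assume "a < S"
    then obtain t where t: "0 < t" "a < ereal (h t)" by (auto simp: S_def less_SUP_iff)
    show "\<forall>\<^sub>F x in at_top. a < ereal (h x)"
      using eventually_ge_at_top[of t]
    proof eventually_elim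
      case (elim x)
      then show ?case using t(2) h_mono[OF t(1) elim] by (simp add: less_le_trans)
    qed
  next
    fix a assume "S < a"
    show "\<forall>\<^sub>F x in at_top. ereal (h x) < a"
      using eventually_gt_at_top[of 0]
      by eventually_elim (use h_le_S \<open>S < a\<close> in \<open>auto intro: le_less_trans\<close>)
  qed
  have "((\<lambda>t. \<Psi> 0 / t) \<longlongrightarrow> 0) at_top"
    by (intro tendsto_divide_0[OF tendsto_const] filterlim_at_top_imp_at_infinity filterlim_ident)
  then have "((\<lambda>t. ereal (\<Psi> 0 / t)) \<longlongrightarrow> 0) at_top"
    unfolding zero_ereal_def by (rule tendsto_ereal)
  then have "((\<lambda>t. ereal (h t) + ereal (\<Psi> 0 / t)) \<longlongrightarrow> S + 0) at_top"
    by (intro tendsto_add_ereal_general h_lim) auto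
  then have lim: "((\<lambda>t. ereal (\<Psi> t / t)) \<longlongrightarrow> S) at_top"
    by (simp add: h_def add_divide_distrib[symmetric])
  have fin: "legendre \<Psi> s < \<infinity>" if s: "ereal s < S" for s
  proof -
    obtain b where b: "0 < b" "s < h b" using s by (auto simp: S_def less_SUP_iff)
    have "s * t - \<Psi> t \<le> \<bar>s\<bar> * b - \<Psi> 0" if "0 < t" for t
    proof (cases "b \<le> t")
      case True
      then have "s \<le> h t" using h_mono[OF b(1) True] b(2) by simp
      then have "s * t \<le> \<Psi> t - \<Psi> 0" using that by (simp add: h_def pos_le_divide_eq)
      moreover have "0 \<le> \<bar>s\<bar> * b" using b by simp
      ultimately show ?thesis by linarith
    next
      case False
      have "s * t \<le> \<bar>s\<bar> * b" using False that by (intro mult_mono) auto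
      moreover have "\<Psi> 0 \<le> \<Psi> t" using mono that by (auto simp: mono_on_def)
      ultimately show ?thesis by linarith
    qed
    then have "legendre \<Psi> s \<le> ereal (\<bar>s\<bar> * b - \<Psi> 0)" by (simp add: legendre_le_iff)
    then show ?thesis by (auto intro: le_less_trans)
  qed
  show thesis by (rule that[OF \<open>0 \<le> S\<close> lim fin])
qed

text \<open>All moments are written relative to the common value \<open>exp m\<close>. The excess of
  the \<open>p\<close>-moment is at most the logarithm of the first factor of
  \<open>moment_const\<close>, the deficit of the \<open>q\<close>-moment at most that of the
  second; a factor is \<open>1\<close> where the sign of \<open>r / p\<close> or
  \<open>r / q\<close> suffices.\<close>

lemma moments_comparableI:
  assumes mom: "\<And>p K. p \<noteq> 0 \<Longrightarrow> legendre \<Psi> (\<bar>p\<bar> * L) = ereal K \<Longrightarrow>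
      \<exists>r. 0 \<le> r \<and> r \<le> K \<and> Lp_moment \<mu> 0 f = ennreal (exp m) \<and>
        Lp_moment \<mu> p f = ennreal (exp (m + r / p))"
    and fin: "\<And>p. p \<in> I \<Longrightarrow> p \<noteq> 0 \<Longrightarrow> legendre \<Psi> (\<bar>p\<bar> * L) < \<infinity>"
  shows "moments_comparable \<mu> f I (moment_const L \<Psi>)"
  unfolding moments_comparable_def
proof (intro ballI impI)
  fix q p assume I: "q \<in> I" "p \<in> I" and "q < p"
  have legendre_real: "\<exists>K. legendre \<Psi> (\<bar>x\<bar> * L) = ereal K" if "x \<in> I" "x \<noteq> 0" for x
    using fin[OF that] by (cases rule: legendre_cases[of \<Psi> "\<bar>x\<bar> * L"]) auto
  \<comment> \<open>\<open>mom\<close> speaks of nonzero exponents; of the distinct \<open>q\<close>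
    and \<open>p\<close>, at least one is nonzero.\<close>
  have zero: "Lp_moment \<mu> 0 f = ennreal (exp m)"
  proof -
    obtain x where "x \<in> I" "x \<noteq> 0" using \<open>q < p\<close> I by (cases "p = 0") auto
    with legendre_real[of x] mom[of x] show ?thesis by fast
  qed
  have "\<exists>a c. Lp_moment \<mu> p f = ennreal (exp (m + a)) \<and>
      (if 0 < p then C_const L p \<Psi> else 1) = ennreal (exp c) \<and> a \<le> c"
  proof (cases "p = 0")
    case True
    then show ?thesis using zero by (intro exI[of _ 0]) simp
  next
    case False
    obtain K where K: "legendre \<Psi> (\<bar>p\<bar> * L) = ereal K" using legendre_real[OF I(2) False] ..
    obtain r where r: "0 \<le> r" "r \<le> K" "Lp_moment \<mu> p f = ennreal (exp (m + r / p))"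
      using mom[OF False K] by blast
    show ?thesis
    proof (cases "0 < p")
      case True
      then show ?thesis using r C_const_eq(2)[OF True, of \<Psi> L K] K
        by (intro exI[of _ "r / p"] exI[of _ "K / p"]) (simp add: divide_right_mono)
    next
      case False
      then show ?thesis using r
        by (intro exI[of _ "r / p"] exI[of _ 0]) (simp add: divide_nonneg_nonpos)
    qed
  qed
  then obtain a c where p: "Lp_moment \<mu> p f = ennreal (exp (m + a))"
    "(if 0 < p then C_const L p \<Psi> else 1) = ennreal (exp c)" "a \<le> c" by blast
  have "\<exists>b d. Lp_moment \<mu> q f = ennreal (exp (m + b)) \<and>
      (if q < 0 then C_const L (- q) \<Psi> else 1) = ennreal (exp d) \<and> - d \<le> b"
  proof (cases "q = 0")
    case True
    then show ?thesis using zero by (intro exI[of _ 0]) simp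
  next
    case False
    obtain K where K: "legendre \<Psi> (\<bar>q\<bar> * L) = ereal K" using legendre_real[OF I(1) False] ..
    obtain r where r: "0 \<le> r" "r \<le> K" "Lp_moment \<mu> q f = ennreal (exp (m + r / q))"
      using mom[OF False K] by blast
    show ?thesis
    proof (cases "q < 0")
      case True
      then show ?thesis using r C_const_eq(2)[of "- q" \<Psi> L K] K
        by (intro exI[of _ "r / q"] exI[of _ "K / - q"]) (simp add: divide_right_mono_neg)
    next
      case False
      then show ?thesis using r
        by (intro exI[of _ "r / q"] exI[of _ 0]) simp
    qed
  qed
  then obtain b d where q: "Lp_moment \<mu> q f = ennreal (exp (m + b))"
    "(if q < 0 then C_const L (- q) \<Psi> else 1) = ennreal (exp d)" "- d \<le> b" by blast
  have const: "moment_const L \<Psi> p q = ennreal (exp (c + d))"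
    unfolding moment_const_def p(2) q(2) by (simp add: exp_add ennreal_mult)
  have "Lp_moment \<mu> p f \<le> ennreal (exp (c + d + (m + b)))"
    unfolding p(1) using p(3) q(3) by (intro ennreal_leI) simp
  also have "\<dots> = moment_const L \<Psi> p q * Lp_moment \<mu> q f"
    unfolding const q(1) exp_add[of "c + d"] by (simp add: ennreal_mult)
  finally show "moment_const L \<Psi> p q < \<infinity> \<and>
      Lp_moment \<mu> p f \<le> moment_const L \<Psi> p q * Lp_moment \<mu> q f"
    using const by simp
qed

text \<open>In \<open>ennreal\<close> the product of \<open>\<infinity>\<close> and \<open>0\<close>
  is \<open>0\<close>, whereas the mathematical inequality treats it as indeterminate. This explains
  the guard on the bound by the moment of order \<open>- p\<close>.\<close>

theorem theorem3p1:
  fixes \<mu> :: "'a :: polish_space measure"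
    and \<phi> \<Phi> \<Psi> :: "real \<Rightarrow> real"
    and L :: real
  assumes "borel_prob \<mu>"
    and "convex_on {0..} \<phi>" "mono_on {0..} \<phi>" "continuous_on {0..} \<phi>"
    and "\<forall>t\<ge>0. 0 \<le> \<phi> t" "\<phi> 0 = 0"
    and "convex_on {0..} \<Phi>" "mono_on {0..} \<Phi>" "continuous_on {0..} \<Phi>"
    and "transport_entropy \<phi> \<Phi> \<mu> \<or> infimum_convolution \<phi> \<Phi> \<mu>"
    and "\<Psi> = \<Phi> \<circ> \<phi>"
    and "0 < L"
  shows "(\<forall>p>0. 1 \<le> C_const L p \<Psi>) \<and>
    (\<forall>f p. log_lipschitz L f \<and> 0 < p \<longrightarrow>
      inverse (C_const L p \<Psi>) * Lp_moment \<mu> p f \<le> Lp_moment \<mu> 0 f \<and>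
      (\<not> (C_const L p \<Psi> = \<infinity> \<and> Lp_moment \<mu> (- p) f = 0) \<longrightarrow>
        Lp_moment \<mu> 0 f \<le> C_const L p \<Psi> * Lp_moment \<mu> (- p) f)) \<and>
    (\<exists>S::ereal. 0 \<le> S \<and> ((\<lambda>t. ereal (\<Psi> t / t)) \<longlongrightarrow> S) at_top \<and>
      (S = \<infinity> \<longrightarrow>
        (\<forall>p>0. C_const L p \<Psi> < \<infinity>) \<and>
        (\<forall>M>0. \<forall>f. log_lipschitz M f \<longrightarrow>
          moments_comparable \<mu> f UNIV (moment_const M \<Psi>))) \<and>
      (S < \<infinity> \<longrightarrow>
        (\<forall>p>0. ereal p < S / ereal L \<longrightarrow> C_const L p \<Psi> < \<infinity>) \<and>
        (\<forall>f. log_lipschitz L f \<longrightarrow>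
          moments_comparable \<mu> f {p. - (S / ereal L) < ereal p \<and> ereal p < S / ereal L}
            (moment_const L \<Psi>))))"
proof -
  note \<mu> = assms(1)
  note \<phi> = assms(2,4,5,6) and \<Phi> = assms(7,8,9) and ineq = assms(10) and \<Psi> = assms(11)
  note L = \<open>0 < L\<close>
  have exp_mean: "(\<integral>x. exp (g x) \<partial>\<mu>) \<le> exp (integral\<^sup>L \<mu> g + M)"
    if s: "0 < s" and M: "legendre \<Psi> s \<le> ereal M"
      and g: "s-lipschitz_on UNIV g" "\<And>x. \<bar>g x\<bar> \<le> B" for s M B and g :: "'a \<Rightarrow> real"
  proof -
    obtain l K where lK: "0 < l" "\<And>u. 0 \<le> u \<Longrightarrow> s * u - l * \<phi> u \<le> K"
      "\<And>t. 0 \<le> t \<Longrightarrow> l * t - \<Phi> t \<le> M - K"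
      using legendre_multiplier[OF \<phi> \<Phi> s M[unfolded \<Psi>]] by blast
    from ineq show ?thesis
    proof
      assume "transport_entropy \<phi> \<Phi> \<mu>"
      from exp_mean_transport_entropy[OF \<mu> this lK \<phi>(2,3) g] show ?thesis .
    next
      assume "infimum_convolution \<phi> \<Phi> \<mu>"
      from exp_mean_infimum_convolution[OF \<mu> this lK g] show ?thesis .
    qed
  qed
  \<comment> \<open>The function \<open>p * ln (f x)\<close> is Lipschitz with constant
    \<open>\<bar>p\<bar> * M\<close>, so exponents of either sign lead to the same Legendre
    value.\<close>
  have moment: "\<exists>r. 0 \<le> r \<and> r \<le> K \<and> Lp_moment \<mu> 0 f = ennreal (exp (\<integral>x. ln (f x) \<partial>\<mu>)) \<and>
      Lp_moment \<mu> p f = ennreal (exp ((\<integral>x. ln (f x) \<partial>\<mu>) + r / p))"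
    if M: "0 < M" and f: "log_lipschitz M f" and p: "p \<noteq> 0"
      and K: "legendre \<Psi> (\<bar>p\<bar> * M) = ereal K" for M K p and f :: "'a \<Rightarrow> real"
  proof -
    have f_pos: "0 < f x" for x using f by (simp add: log_lipschitz_def)
    have pos: "0 < \<bar>p\<bar> * M" using M p by simp
    have lip: "(\<bar>p\<bar> * M)-lipschitz_on UNIV (\<lambda>x. p * ln (f x))"
    proof (rule lipschitz_onI)
      fix x y
      have "\<bar>p\<bar> * \<bar>ln (f x) - ln (f y)\<bar> \<le> \<bar>p\<bar> * (M * dist x y)"
        using f by (intro mult_left_mono) (auto simp: log_lipschitz_def)
      then show "dist (p * ln (f x)) (p * ln (f y)) \<le> \<bar>p\<bar> * M * dist x y"
        by (simp add: dist_real_def flip: right_diff_distrib abs_mult)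
    qed (use pos in simp)
    have bounded: "(\<integral>x. exp (g x) \<partial>\<mu>) \<le> exp (integral\<^sup>L \<mu> g + K)"
      if "(\<bar>p\<bar> * M)-lipschitz_on UNIV g" "\<And>x. \<bar>g x\<bar> \<le> B" for g :: "'a \<Rightarrow> real" and B
      using exp_mean[OF pos _ that, of K] K by simp
    have "integrable \<mu> (\<lambda>x. p * ln (f x))"
      by (rule lipschitz_exp_moment(1)[OF \<mu> _ lip]) (rule bounded)
    moreover have "(\<integral>\<^sup>+ x. ennreal (exp (p * ln (f x))) \<partial>\<mu>) \<le>
        ennreal (exp ((\<integral>x. p * ln (f x) \<partial>\<mu>) + K))"
      by (rule lipschitz_exp_moment(2)[OF \<mu> _ lip]) (rule bounded)
    ultimately have int: "integrable \<mu> (\<lambda>x. ln (f x))" and le: "(\<integral>\<^sup>+ x. ennreal (exp (p * ln (f x))) \<partial>\<mu>) \<le>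
        ennreal (exp (p * (\<integral>x. ln (f x) \<partial>\<mu>) + K))"
      using p by simp_all
    have "Lp_moment \<mu> 0 f = ennreal (exp (\<integral>x. ln (f x) \<partial>\<mu>))"
      by (simp add: Lp_moment_def ext_integral_eq_integral[OF int] exp_ereal_def)
    then show ?thesis
      using Lp_moment_eq_exp[OF borel_probD(1)[OF \<mu>] f_pos int p le] by metis
  qed
  have C_ge: "1 \<le> C_const L p \<Psi>" if p: "0 < p" for p
  proof (cases rule: legendre_cases[of \<Psi> "p * L"])
    case (2 K)
    \<comment> \<open>The sign of \<open>\<Phi> 0\<close> is not prescribed, so nonnegativity of the
      Legendre value comes from the inequality for \<open>\<mu>\<close>, tested on a constant
      function.\<close>
    have "log_lipschitz L (\<lambda>x :: 'a. 1)" using L by (simp add: log_lipschitz_def)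
    from moment[OF L this, of p K] 2 p have "0 \<le> K" by auto
    then show ?thesis using C_const_eq(2)[OF p 2] p by simp
  qed (simp add: C_const_eq(1)[OF p])
  have zero_le: "inverse (C_const L p \<Psi>) * Lp_moment \<mu> p f \<le> Lp_moment \<mu> 0 f \<and>
      (\<not> (C_const L p \<Psi> = \<infinity> \<and> Lp_moment \<mu> (- p) f = 0) \<longrightarrow>
        Lp_moment \<mu> 0 f \<le> C_const L p \<Psi> * Lp_moment \<mu> (- p) f)"
    if f: "log_lipschitz L f" and p: "0 < p" for p and f :: "'a \<Rightarrow> real"
  proof (cases rule: legendre_cases[of \<Psi> "p * L"])
    case 1
    then show ?thesis using C_const_eq(1)[OF p 1] by (auto simp: ennreal_top_mult)
  next
    case (2 K)
    define m where "m = (\<integral>x. ln (f x) \<partial>\<mu>)"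
    note C = C_const_eq(2)[OF p 2]
    have zero: "Lp_moment \<mu> 0 f = ennreal (exp m)"
      using moment[OF L f, of p K] 2 p by (auto simp: m_def)
    obtain r where r: "r \<le> K" "Lp_moment \<mu> p f = ennreal (exp (m + r / p))"
      using moment[OF L f, of p K] 2 p by (auto simp: m_def)
    \<comment> \<open>With exponent \<open>- p\<close> the correction is \<open>- r' / p\<close>,
      which is at least \<open>- K / p\<close>; this is the second inequality.\<close>
    obtain r' where r': "r' \<le> K" "Lp_moment \<mu> (- p) f = ennreal (exp (m + r' / (- p)))"
      using moment[OF L f, of "- p" K] 2 p by (auto simp: m_def)
    have "inverse (C_const L p \<Psi>) * Lp_moment \<mu> p f = ennreal (exp (- (K / p) + (m + r / p)))"
      unfolding C r(2) exp_add[of "- (K / p)"] by (simp add: inverse_ennreal ennreal_mult exp_minus)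
    moreover have "C_const L p \<Psi> * Lp_moment \<mu> (- p) f = ennreal (exp (K / p + (m + r' / - p)))"
      unfolding C r'(2) exp_add[of "K / p"] by (simp add: ennreal_mult)
    ultimately show ?thesis
      using divide_right_mono[OF r(1), of p] divide_right_mono[OF r'(1), of p] p
      unfolding zero by simp
  qed
  have \<Psi>_mono: "mono_on {0..} \<Psi>"
    using assms(3) \<Phi>(2) \<phi>(3) unfolding \<Psi> mono_on_def by simp
  have \<Psi>_convex: "convex_on {0..} \<Psi>"
    unfolding \<Psi>
  proof (rule convex_onI)
    fix t x y :: real assume t: "0 < t" "t < 1" and xy: "x \<in> {0..}" "y \<in> {0..}"
    let ?z = "(1 - t) * x + t * y" and ?w = "(1 - t) * \<phi> x + t * \<phi> y"
    have "\<phi> ?z \<le> ?w" using convex_onD[OF \<phi>(1), of t x y] t xy by simp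
    moreover have "0 \<le> \<phi> ?z" using \<phi>(3) t xy by simp
    ultimately have "\<Phi> (\<phi> ?z) \<le> \<Phi> ?w" using \<Phi>(2) unfolding mono_on_def by simp
    also have "\<dots> \<le> (1 - t) * \<Phi> (\<phi> x) + t * \<Phi> (\<phi> y)"
      using convex_onD[OF \<Phi>(1), of t "\<phi> x" "\<phi> y"] t xy \<phi>(3) by simp
    finally show "(\<Phi> \<circ> \<phi>) ((1 - t) *\<^sub>R x + t *\<^sub>R y) \<le> (1 - t) * (\<Phi> \<circ> \<phi>) x + t * (\<Phi> \<circ> \<phi>) y"
      by simp
  qed (simp add: convex_real_interval)
  obtain S :: ereal where S: "0 \<le> S" "((\<lambda>t. ereal (\<Psi> t / t)) \<longlongrightarrow> S) at_top"
    and fin: "\<And>s. ereal s < S \<Longrightarrow> legendre \<Psi> s < \<infinity>"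
    using convex_slope_limit[OF \<Psi>_convex \<Psi>_mono] by blast
  have C_fin: "C_const L p \<Psi> < \<infinity>" if "0 < p" "ereal (p * L) < S" for p
    using fin[OF that(2)] C_const_eq(2)[OF that(1)]
    by (cases rule: legendre_cases[of \<Psi> "p * L"]) auto
  have below: "ereal (p * L) < S" if "ereal p < S / ereal L" for p
    using that L S(1) by (cases S) (auto simp: pos_less_divide_eq)
  have below_abs: "ereal (\<bar>p\<bar> * L) < S" if "- (S / ereal L) < ereal p" "ereal p < S / ereal L" for p
    using that below[of "\<bar>p\<bar>"] by (cases "0 \<le> p") (auto simp: ereal_uminus_less_reorder)
  \<comment> \<open>The Lipschitz constant \<open>M\<close> is left free: for
    \<open>S = \<infinity>\<close> every \<open>M\<close> is admissible, for finite \<open>S\<close>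
    the case \<open>M = L\<close> is used.\<close>
  have comparable: "moments_comparable \<mu> f I (moment_const M \<Psi>)"
    if "0 < M" "log_lipschitz M f" "\<And>p. p \<in> I \<Longrightarrow> ereal (\<bar>p\<bar> * M) < S" for M f I
  proof (rule moments_comparableI)
    show "legendre \<Psi> (\<bar>p\<bar> * M) < \<infinity>" if "p \<in> I" for p
      using fin that \<open>\<And>p. p \<in> I \<Longrightarrow> ereal (\<bar>p\<bar> * M) < S\<close> by blast
  qed (rule moment[OF that(1,2)])
  show ?thesis
    using C_ge zero_le S L
    by (intro conjI exI[of _ S] allI impI comparable C_fin) (auto simp: below below_abs)
qed

end
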